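(* Let $\alpha\ge2$ be an integer. Using reconstruction-based rebalancing based on the $\alpha$-labeling, the amortized cost (in the Asymmetric NP model) of each update (insertion or deletion) to maintain the balancing information on a tree of size $n$ is $O((\omega+\alpha)\log_\alpha n)$.
   Context: The tree is a binary search tree over $n$ objects (such as an interval tree, priority search tree or range tree) in which a subtree of weight $n'$ can be rebuilt, with sibling subtree weights differing by at most one, in $O(\omega n')$ work from the sorted order of its objects. The weight $|x|$ of a node is the number of nodes in its subtree plus one. $\alpha$-labeling: a node is critical if for some integer $i\ge0$ either its weight lies in $[2\alpha^i,4\alpha^i-2]$, or its weight is $2\alpha^i-1$ and its sibling's weight is $2\alpha^i$; other nodes are secondary; the root is treated as a virtual critical node. Only critical nodes store their weights (the balancing information). The initial weight of a critical node is its weight when labeled. Reconstruction-based rebalancing: insertions are performed without rotations; when a critical node's weight reaches twice its initial weight $s$, its subtree is rebuilt (balanced) and relabeled, except that if $s\le 4\alpha^i-2$ and $2\alpha^{i+1}-1\le 2s$ for some $i$ the new subtree root is not marked critical; the topmost qualifying node is rebuilt. Deletions mark objects as deleted and a subtree is rebuilt once a constant fraction of its objects are deleted. Asymmetric NP model: each write to the large memory costs $\omega\ge1$, all other operations including reads cost $1$; small private symmetric memory of $\Theta(\log n)$ words.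
   Formalization: Deletions trigger a rebuild only of the whole tree, once a constant fraction of all its objects are marked; applying that rule at every critical subtree can destroy a critical level and make the bound false. log_α n is read as max(1, log_α n). *)

theory Defs
  imports Complex_Main "HOL-Library.Tree" "HOL-Library.Monad_Syntax"
begin

section \<open>Computations with cost in the asymmetric memory model\<close>

text \<open>A computation returns its result together with the number of unit-cost operations
  (reads of the large memory and instructions) and the number of writes to the large memory.\<close>

type_synonym 'a comp = "'a \<times> nat \<times> nat"

definition ret :: "'a \<Rightarrow> 'a comp" where
  "ret x = (x, 0, 0)"

definition tick :: "nat \<Rightarrow> unit comp" where
  "tick m = ((), m, 0)"

definition writes :: "nat \<Rightarrow> unit comp" where
  "writes m = ((), 0, m)"

definition bind_comp :: "'a comp \<Rightarrow> ('a \<Rightarrow> 'b comp) \<Rightarrow> 'b comp" where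
  "bind_comp m f =
     (case m of (x, r, w) \<Rightarrow> case f x of (y, r', w') \<Rightarrow> (y, r + r', w + w'))"

adhoc_overloading Monad_Syntax.bind \<rightleftharpoons> bind_comp

definition result :: "'a comp \<Rightarrow> 'a" where
  "result m = fst m"

definition work :: "real \<Rightarrow> 'a comp \<Rightarrow> real" where
  "work \<omega> m = (case m of (_, r, w) \<Rightarrow> real r + \<omega> * real w)"


section \<open>Trees with partial balancing information\<close>

text \<open>An item is a key with a flag telling whether the object is marked as deleted. The label of a
  critical node is \<^term>\<open>Some (s, w)\<close> with its initial weight \<^term>\<open>s\<close> and its
  current weight \<^term>\<open>w\<close>; secondary nodes have label \<^term>\<open>None\<close>. The weight of a
  subtree is \<^const>\<open>size1\<close>; nodes marked as deleted count.\<close>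

type_synonym 'k item = "'k \<times> bool"
type_synonym label = "(nat \<times> nat) option"
type_synonym 'k ltree = "('k item \<times> label) tree"

text \<open>The second component counts the nodes marked as deleted.\<close>

type_synonym 'k state = "'k ltree \<times> nat"

type_synonym 'k builder = "'k item list \<Rightarrow> 'k item tree comp"

text \<open>The construction routine of the underlying search tree (interval tree, priority search tree,
  range tree, \dots): from the sorted sequence of the objects of a subtree of weight
  \<^term>\<open>m\<close> it produces, with work at most \<^term>\<open>K * \<omega> * m\<close>, a search tree whose sibling
  subtree weights differ by at most one (\<^const>\<open>wbalanced\<close>).\<close>

definition rebuilder :: "real \<Rightarrow> real \<Rightarrow> ('k :: linorder) builder \<Rightarrow> bool" where
  "rebuilder K \<omega> build \<longleftrightarrow>
     (\<forall>xs. sorted_wrt (<) (map fst xs) \<longrightarrow>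
        inorder (result (build xs)) = xs \<and> wbalanced (result (build xs)) \<and>
        work \<omega> (build xs) \<le> K * \<omega> * real (length xs + 1))"


section \<open>Labeling\<close>

definition critical_range :: "nat \<Rightarrow> nat \<Rightarrow> bool" where
  "critical_range \<alpha> w \<longleftrightarrow> (\<exists>i. 2 * \<alpha> ^ i \<le> w \<and> w \<le> 4 * \<alpha> ^ i - 2)"

definition critical :: "nat \<Rightarrow> nat \<Rightarrow> nat \<Rightarrow> bool" where
  "critical \<alpha> w sib \<longleftrightarrow>
     critical_range \<alpha> w \<or> (\<exists>i. w = 2 * \<alpha> ^ i - 1 \<and> sib = 2 * \<alpha> ^ i)"

text \<open>\<^term>\<open>c\<close> tells whether the topmost node is marked critical. The weights are computed
  during the same traversal; only those of critical nodes are written.\<close>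

fun label_tree :: "nat \<Rightarrow> bool \<Rightarrow> 'a tree \<Rightarrow> ('a \<times> label) tree comp" where
  "label_tree \<alpha> c \<langle>\<rangle> = ret \<langle>\<rangle>"
| "label_tree \<alpha> c \<langle>l, a, r\<rangle> = do {
     tick 2;
     l' \<leftarrow> label_tree \<alpha> (critical \<alpha> (size1 l) (size1 r)) l;
     r' \<leftarrow> label_tree \<alpha> (critical \<alpha> (size1 r) (size1 l)) r;
     (if c then writes 1 else ret ());
     let w = size1 l + size1 r;
     ret \<langle>l', (a, if c then Some (w, w) else None), r'\<rangle>
   }"

definition flatten :: "'k ltree \<Rightarrow> 'k item list comp" where
  "flatten t = do {
     tick (2 * size t + 1);
     writes (size t);
     ret (map fst (inorder t))
   }"

definition build_labeled ::
    "nat \<Rightarrow> 'k builder \<Rightarrow> bool \<Rightarrow> 'k item list \<Rightarrow> 'k ltree comp" where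
  "build_labeled \<alpha> build c xs = do {
     u \<leftarrow> build xs;
     label_tree \<alpha> c u
   }"

text \<open>Whether the root of a subtree rebuilt because its weight reached \<^term>\<open>2 * s\<close> is marked
  critical. The sibling clause of \<^const>\<open>critical\<close> cannot hold: it requires an odd weight.\<close>

definition marks_new_root :: "nat \<Rightarrow> nat \<Rightarrow> bool" where
  "marks_new_root \<alpha> s \<longleftrightarrow>
     critical_range \<alpha> (2 * s) \<and>
     \<not> (\<exists>i. s \<le> 4 * \<alpha> ^ i - 2 \<and> 2 * \<alpha> ^ (i + 1) - 1 \<le> 2 * s)"


section \<open>Updates\<close>

text \<open>The result of \<^term>\<open>lookup x t\<close> is \<^term>\<open>None\<close> if there is no node with key
  \<^term>\<open>x\<close>, otherwise its deletion mark. All passes run from the root downwards, hence need only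
  constant private memory.\<close>

fun lookup :: "'k :: linorder \<Rightarrow> 'k ltree \<Rightarrow> bool option comp" where
  "lookup x \<langle>\<rangle> = do { tick 1; ret None }"
| "lookup x \<langle>l, ((k, d), _), r\<rangle> = do {
     tick 2;
     if x < k then lookup x l else if k < x then lookup x r else ret (Some d)
   }"

fun set_mark :: "'k :: linorder \<Rightarrow> bool \<Rightarrow> 'k ltree \<Rightarrow> 'k ltree comp" where
  "set_mark x b \<langle>\<rangle> = do { tick 1; ret \<langle>\<rangle> }"
| "set_mark x b \<langle>l, ((k, d), lb), r\<rangle> = do {
     tick 2;
     if x < k then do { l' \<leftarrow> set_mark x b l; ret \<langle>l', ((k, d), lb), r\<rangle> }
     else if k < x then do { r' \<leftarrow> set_mark x b r; ret \<langle>l, ((k, d), lb), r'\<rangle> }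
     else do { writes 1; ret \<langle>l, ((k, b), lb), r\<rangle> }
   }"

text \<open>Insertion of an absent key without rotations, incrementing the stored weights on the search
  path. The new leaf has weight 2 and is thus critical. It costs two writes, one for the node and
  one for the pointer to it.\<close>

fun grow :: "'k :: linorder \<Rightarrow> 'k ltree \<Rightarrow> 'k ltree comp" where
  "grow x \<langle>\<rangle> = do { tick 1; writes 2; ret \<langle>\<langle>\<rangle>, ((x, False), Some (2, 2)), \<langle>\<rangle>\<rangle> }"
| "grow x \<langle>l, ((k, d), lb), r\<rangle> = do {
     tick 2;
     lb' \<leftarrow> (case lb of
        None \<Rightarrow> ret None
      | Some (s, w) \<Rightarrow> do { writes 1; ret (Some (s, w + 1)) });
     if x < k then do { l' \<leftarrow> grow x l; ret \<langle>l', ((k, d), lb'), r\<rangle> }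
     else do { r' \<leftarrow> grow x r; ret \<langle>l, ((k, d), lb'), r'\<rangle> }
   }"

text \<open>Rebuilds the topmost critical node on the search path of \<^term>\<open>x\<close> whose weight has
  reached twice its initial weight. Nodes marked as deleted are kept, so the weight of the new
  subtree is \<^term>\<open>2 * s\<close>. The flag \<^term>\<open>at_root\<close> holds at the root of the whole tree,
  which is always (virtually) critical.\<close>

fun repair :: "nat \<Rightarrow> ('k :: linorder) builder \<Rightarrow> bool \<Rightarrow> 'k \<Rightarrow> 'k ltree \<Rightarrow> 'k ltree comp" where
  "repair \<alpha> build at_root x \<langle>\<rangle> = do { tick 1; ret \<langle>\<rangle> }"
| "repair \<alpha> build at_root x \<langle>l, ((k, d), lb), r\<rangle> = do {
     tick 2;
     if (case lb of None \<Rightarrow> False | Some (s, w) \<Rightarrow> 2 * s \<le> w) then do {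
       xs \<leftarrow> flatten \<langle>l, ((k, d), lb), r\<rangle>;
       u \<leftarrow> build_labeled \<alpha> build (at_root \<or> marks_new_root \<alpha> (fst (the lb))) xs;
       writes 1;
       ret u
     }
     else if x < k then do {
       l' \<leftarrow> repair \<alpha> build False x l; ret \<langle>l', ((k, d), lb), r\<rangle> }
     else if k < x then do {
       r' \<leftarrow> repair \<alpha> build False x r; ret \<langle>l, ((k, d), lb), r'\<rangle> }
     else ret \<langle>l, ((k, d), lb), r\<rangle>
   }"

text \<open>A deleted object that is inserted again is unmarked.\<close>

definition insert_op :: "nat \<Rightarrow> ('k :: linorder) builder \<Rightarrow> 'k \<Rightarrow> 'k state \<Rightarrow> 'k state comp" where
  "insert_op \<alpha> build x = (\<lambda>(t, dead). do {
     st \<leftarrow> lookup x t;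
     case st of
       None \<Rightarrow> do {
         t1 \<leftarrow> grow x t;
         t2 \<leftarrow> repair \<alpha> build True x t1;
         ret (t2, dead) }
     | Some b \<Rightarrow>
         if b then do { t' \<leftarrow> set_mark x False t; writes 1; ret (t', dead - 1) }
         else ret (t, dead)
   })"

text \<open>The root is critical in every reachable tree, so its weight is always stored.\<close>

fun root_weight :: "'k ltree \<Rightarrow> nat" where
  "root_weight \<langle>\<rangle> = 1"
| "root_weight \<langle>_, (_, lb), _\<rangle> = (case lb of None \<Rightarrow> 1 | Some (s, w) \<Rightarrow> w)"

text \<open>The subtree that deletions cause to be rebuilt is that of the virtual critical root: the marked
  objects are dropped as soon as they are a fraction \<^term>\<open>\<delta>\<close> of all objects in it. If they
  were dropped at other critical nodes as well, the new subtree could become too light for the level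
  of the node, no critical node of that level would remain on the paths below, and these could grow
  to length proportional to \<^term>\<open>\<alpha>\<^sup>2\<close> between consecutive levels.\<close>

definition delete_op ::
    "real \<Rightarrow> nat \<Rightarrow> ('k :: linorder) builder \<Rightarrow> 'k \<Rightarrow> 'k state \<Rightarrow> 'k state comp" where
  "delete_op \<delta> \<alpha> build x = (\<lambda>(t, dead). do {
     st \<leftarrow> lookup x t;
     if st = Some False then do {
       t' \<leftarrow> set_mark x True t;
       writes 1;
       tick 1;
       if \<delta> * real (root_weight t' - 1) \<le> real (dead + 1) then do {
         xs \<leftarrow> flatten t';
         u \<leftarrow> build_labeled \<alpha> build True (filter (\<lambda>(_, d). \<not> d) xs);
         writes 2;
         ret (u, 0)
       }
       else ret (t', dead + 1)
     }
     else ret (t, dead)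
   })"

datatype 'k update = Insert 'k | Delete 'k

fun perform ::
    "real \<Rightarrow> nat \<Rightarrow> ('k :: linorder) builder \<Rightarrow> 'k update \<Rightarrow> 'k state \<Rightarrow> 'k state comp" where
  "perform \<delta> \<alpha> build (Insert x) S = insert_op \<alpha> build x S"
| "perform \<delta> \<alpha> build (Delete x) S = delete_op \<delta> \<alpha> build x S"

definition initial_state :: "nat \<Rightarrow> 'k builder \<Rightarrow> 'k list \<Rightarrow> 'k state" where
  "initial_state \<alpha> build ks =
     (result (build_labeled \<alpha> build True (map (\<lambda>k. (k, False)) ks)), 0)"

definition state_after ::
    "real \<Rightarrow> nat \<Rightarrow> ('k :: linorder) builder \<Rightarrow> 'k list \<Rightarrow> 'k update list \<Rightarrow> 'k state" where
  "state_after \<delta> \<alpha> build ks us =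
     foldl (\<lambda>S u. result (perform \<delta> \<alpha> build u S)) (initial_state \<alpha> build ks) us"

text \<open>The number of objects that are present, i.e. not marked as deleted.\<close>

definition num_objects :: "'k state \<Rightarrow> nat" where
  "num_objects S = length (filter (\<lambda>((_, d), _). \<not> d) (inorder (fst S)))"

end

theory Submission
  imports Defs
begin

text \<open>Assign level \<open>i\<close> to a critical node whose initial weight lies between \<open>2\<alpha>\<^sup>i - 1\<close> and
  \<open>4\<alpha>\<^sup>i - 2\<close>. In a freshly built tree every downward path meets exactly one critical node of each
  level below that of its top, in decreasing order. Updates preserve this: a critical node of level
  \<open>i\<close> that has doubled is replaced either by a critical node of the same level or by an unmarked
  node whose new subtree is heavy enough to have one node of level \<open>i\<close> on each path. A secondary
  node between levels \<open>i + 1\<close> and \<open>i\<close> has two subtrees of weight at least \<open>2\<alpha>\<^sup>i - 1\<close>, hence each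
  step along a chain of secondary nodes loses that much of a weight below \<open>8\<alpha>\<^bsup>i+1\<^esup>\<close>, so the chain
  has length \<open>O(\<alpha>)\<close>. Paths thus have \<open>O(\<alpha> log\<^sub>\<alpha> n)\<close> nodes of which \<open>O(log\<^sub>\<alpha> n)\<close> are critical. The
  potential \<open>\<omega> \<cdot> (A \<cdot> \<Sum>(w - s) + D \<cdot> dead)\<close>, where the sum is over the critical nodes, pays for the
  rebuilding.\<close>

section \<open>Cost calculus\<close>

lemma result_simps [simp]:
  "result (ret x) = x" "result (bind_comp m f) = result (f (result m))"
  by (simp_all add: result_def ret_def bind_comp_def split: prod.split)

lemma work_simps [simp]:
  "work \<omega> (ret x) = 0" "work \<omega> (tick m) = real m" "work \<omega> (writes m) = \<omega> * real m"
  "work \<omega> (bind_comp c f) = work \<omega> c + work \<omega> (f (result c))"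
  by (auto simp: work_def ret_def tick_def writes_def bind_comp_def result_def algebra_simps
      split: prod.split)

lemma size1_eq: "size1 t = Suc (size t)"
  by (simp add: size1_size)

section \<open>Layered trees\<close>

text \<open>\<open>layered \<alpha> i t\<close>: on every path of \<open>t\<close> there is one critical node of each level below \<open>i\<close>.
  Level 0 is special, because leaves of the tree carry no label and a critical node of weight 2 may
  get a critical child.\<close>

fun layered :: "nat \<Rightarrow> nat \<Rightarrow> ('a \<times> label) tree \<Rightarrow> bool" where
  "layered \<alpha> 0 t \<longleftrightarrow> size t \<le> 1"
| "layered \<alpha> (Suc i) \<langle>\<rangle> \<longleftrightarrow> i = 0"
| "layered \<alpha> (Suc i) \<langle>l, (a, None), r\<rangle> \<longleftrightarrow> layered \<alpha> (Suc i) l \<and> layered \<alpha> (Suc i) r"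
| "layered \<alpha> (Suc i) \<langle>l, (a, Some (s, w)), r\<rangle> \<longleftrightarrow>
     2 * \<alpha> ^ i \<le> s + 1 \<and> s + 2 \<le> 4 * \<alpha> ^ i \<and> s \<le> w \<and> w < 2 * s \<and> w = size1 l + size1 r \<and>
     layered \<alpha> i l \<and> layered \<alpha> i r"

text \<open>The virtual critical root may have any weight, so its level is not given by a critical
  range: \<open>L\<close> is the least number with \<open>s + 2 \<le> 4 * \<alpha> ^ L\<close>,
  minimality being the bound \<open>4 * \<alpha> ^ i \<le> s + 1\<close>.\<close>

fun root_layered :: "nat \<Rightarrow> ('a \<times> label) tree \<Rightarrow> bool" where
  "root_layered \<alpha> \<langle>\<rangle> \<longleftrightarrow> True"
| "root_layered \<alpha> \<langle>l, (a, lb), r\<rangle> \<longleftrightarrow>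
     (\<exists>s w L. lb = Some (s, w) \<and> s \<le> w \<and> w < 2 * s \<and> w = size1 l + size1 r \<and> s + 2 \<le> 4 * \<alpha> ^ L \<and>
        (\<forall>i. L = Suc i \<longrightarrow> 4 * \<alpha> ^ i \<le> s + 1) \<and> layered \<alpha> L l \<and> layered \<alpha> L r)"

text \<open>Only critical nodes store weights, so this bounds the number of weights that one
  insertion has to update.\<close>

fun crit_height :: "('a \<times> label) tree \<Rightarrow> nat" where
  "crit_height \<langle>\<rangle> = 0"
| "crit_height \<langle>l, (a, lb), r\<rangle> =
     (if lb = None then 0 else 1) + max (crit_height l) (crit_height r)"

fun slack :: "('a \<times> label) tree \<Rightarrow> nat" where
  "slack \<langle>\<rangle> = 0"
| "slack \<langle>l, (a, lb), r\<rangle> =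
     (case lb of None \<Rightarrow> 0 | Some (s, w) \<Rightarrow> w - s) + slack l + slack r"

section \<open>Path lengths in layered trees\<close>

lemma crit_height_le_height: "crit_height t \<le> height t"
  by (induction t rule: crit_height.induct) auto

text \<open>Each of the \<open>i\<close> levels contributes one critical node to a path; the extra
  one is the single node that level 0 tolerates, which may be critical too.\<close>

lemma crit_height_layered: "layered \<alpha> i t \<Longrightarrow> crit_height t \<le> Suc i"
proof (induction \<alpha> i t rule: layered.induct)
  case (1 \<alpha> t)
  then have "height t \<le> 1"
    by (cases t) auto
  then show ?case
    using crit_height_le_height[of t] by simp
qed auto

text \<open>Secondary nodes only add weight on top of a critical node of level \<open>i\<close>,
  whose weight is at least \<open>2 * \<alpha> ^ i - 1\<close>. The empty tree occurs only for
  \<open>i = 0\<close>, where the bound is 1.\<close>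

lemma size1_layered:
  assumes "1 \<le> \<alpha>"
  shows "layered \<alpha> (Suc i) t \<Longrightarrow> \<alpha> ^ i \<le> size1 t"
proof (induction t)
  case (Node l x r)
  obtain a lb where x: "x = (a, lb)" by (cases x)
  show ?case
  proof (cases lb)
    case None
    then show ?thesis using Node x by simp
  next
    case (Some sw)
    have "1 \<le> \<alpha> ^ i" using assms by simp
    with Some Node.prems x show ?thesis by (cases sw) auto
  qed
qed simp

text \<open>Descending from a secondary node discards a sibling of weight at least
  \<open>\<alpha> ^ i\<close>, so \<open>size1\<close> pays for each step of the chain. The chain
  ends at a critical node of level \<open>i\<close>, below which \<open>H\<close> bounds the
  height.\<close>

lemma height_layered_step:
  assumes "1 \<le> \<alpha>"
    and "\<And>t :: ('a \<times> label) tree. layered \<alpha> i t \<Longrightarrow> size1 t \<le> 8 * \<alpha> ^ i \<Longrightarrow> height t \<le> H"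
  shows "layered \<alpha> (Suc i) (t :: ('a \<times> label) tree) \<Longrightarrow>
    \<alpha> ^ i * height t \<le> size1 t + \<alpha> ^ i * (H + 1)"
proof (induction t)
  case (Node l x r)
  obtain a lb where x: "x = (a, lb)" by (cases x)
  show ?case
  proof (cases lb)
    case None
    then have lay: "layered \<alpha> (Suc i) l" "layered \<alpha> (Suc i) r"
      using Node.prems x by auto
    note IH = Node.IH(1)[OF lay(1)] Node.IH(2)[OF lay(2)]
    note sz = size1_layered[OF assms(1) lay(1)] size1_layered[OF assms(1) lay(2)]
    show ?thesis
      using IH sz by (cases "height l \<le> height r") (simp_all add: max_def)
  next
    case (Some sw)
    obtain s w where sw: "sw = (s, w)" by (cases sw)
    have *: "layered \<alpha> i l" "layered \<alpha> i r" "size1 l + size1 r < 2 * s" "s + 2 \<le> 4 * \<alpha> ^ i"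
      using Node.prems x Some sw by auto
    \<comment> \<open>The weight of a critical node stays below \<open>2 * s\<close>, hence below
      \<open>8 * \<alpha> ^ i\<close>, as \<open>H\<close> requires.\<close>
    have "height l \<le> H" "height r \<le> H"
      using * by (auto intro!: assms(2))
    then have "height \<langle>l, x, r\<rangle> \<le> H + 1" by simp
    then have "\<alpha> ^ i * height \<langle>l, x, r\<rangle> \<le> \<alpha> ^ i * (H + 1)"
      by (rule mult_le_mono2)
    also have "\<dots> \<le> size1 \<langle>l, x, r\<rangle> + \<alpha> ^ i * (H + 1)"
      by (rule le_add2)
    finally show ?thesis .
  qed
qed simp

text \<open>Each level costs a secondary chain of length \<open>8 * \<alpha>\<close> and one
  critical node; the factor 9 absorbs that node because \<open>\<alpha>\<close> is at least
  1.\<close>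

lemma height_layered:
  assumes "1 \<le> \<alpha>"
  shows "layered \<alpha> i t \<Longrightarrow> size1 t \<le> 8 * \<alpha> ^ i \<Longrightarrow> height t \<le> 9 * \<alpha> * i + 1"
proof (induction i arbitrary: t)
  case 0
  then show ?case by (cases t) auto
next
  case (Suc i)
  have "\<alpha> ^ i * height t \<le> size1 t + \<alpha> ^ i * (9 * \<alpha> * i + 1 + 1)"
    using Suc by (intro height_layered_step assms) auto
  also have "\<dots> \<le> \<alpha> ^ i * (8 * \<alpha> + (9 * \<alpha> * i + 1 + 1))"
    using Suc.prems(2) by (simp add: algebra_simps)
  finally have "height t \<le> 8 * \<alpha> + (9 * \<alpha> * i + 1 + 1)"
    using assms by (subst (asm) mult_le_cancel1) simp
  also have "\<dots> \<le> 9 * \<alpha> * Suc i + 1"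
    using assms by simp
  finally show ?case .
qed

text \<open>By minimality of \<open>L\<close>, the root weight is at least
  \<open>4 * \<alpha> ^ (L - 1) - 1\<close> when \<open>L > 0\<close>, which makes the number of
  levels logarithmic in the size.\<close>

lemma root_layered_heights:
  assumes "2 \<le> \<alpha>" and "root_layered \<alpha> t" and "t \<noteq> \<langle>\<rangle>"
  obtains L where "height t \<le> 9 * \<alpha> * L + 2" "crit_height t \<le> L + 2"
    "L = 0 \<or> \<alpha> ^ (L - 1) \<le> size t"
proof -
  obtain l a lb r where t: "t = \<langle>l, (a, lb), r\<rangle>"
    using assms(3) by (metis surj_pair tree.exhaust)
  obtain s w L where *: "lb = Some (s, w)" "s \<le> w" "w < 2 * s" "w = size1 l + size1 r"
      "s + 2 \<le> 4 * \<alpha> ^ L" "\<And>i. L = Suc i \<Longrightarrow> 4 * \<alpha> ^ i \<le> s + 1" "layered \<alpha> L l" "layered \<alpha> L r"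
    using assms(2) unfolding t by auto
  have "height l \<le> 9 * \<alpha> * L + 1" "height r \<le> 9 * \<alpha> * L + 1"
    using * assms(1) by (intro height_layered; simp)+
  then have "height t \<le> 9 * \<alpha> * L + 2" by (simp add: t)
  moreover have "crit_height t \<le> L + 2"
    using crit_height_layered[OF *(7)] crit_height_layered[OF *(8)] by (simp add: t)
  moreover have "L = 0 \<or> \<alpha> ^ (L - 1) \<le> size t"
  proof (cases L)
    case (Suc i)
    have "1 \<le> \<alpha> ^ i" using assms(1) by simp
    then show ?thesis
      using *(6)[OF Suc] *(2,4) Suc by (simp add: t size1_eq)
  qed simp
  ultimately show thesis by (rule that)
qed

section \<open>Labeling a balanced tree\<close>

lemma size_label_tree [simp]: "size (result (label_tree \<alpha> c u)) = size u"
  by (induction \<alpha> c u rule: label_tree.induct) (auto simp: Let_def)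

lemma size1_label_tree [simp]: "size1 (result (label_tree \<alpha> c u)) = size1 u"
  by (simp add: size1_eq)

lemma inorder_label_tree [simp]: "map fst (inorder (result (label_tree \<alpha> c u))) = inorder u"
  by (induction \<alpha> c u rule: label_tree.induct) (auto simp: Let_def)

lemma slack_label_tree [simp]: "slack (result (label_tree \<alpha> c u)) = 0"
  by (induction \<alpha> c u rule: label_tree.induct) (auto simp: Let_def)

lemma work_label_tree:
  "0 \<le> \<omega> \<Longrightarrow> work \<omega> (label_tree \<alpha> c u) \<le> (2 + \<omega>) * real (size u)"
  by (induction \<alpha> c u rule: label_tree.induct) (auto simp: Let_def algebra_simps)

section \<open>Critical weights and the gaps between them\<close>

lemma power_less_imp_Suc_le:
  fixes \<alpha> :: nat
  assumes "2 \<le> \<alpha>" and "i < j"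
  shows "\<alpha> ^ Suc i \<le> \<alpha> ^ j"
  using assms by (intro power_increasing) auto

text \<open>Such weights lie strictly between the end \<open>4 * \<alpha> ^ i - 2\<close> of one
  range and the start \<open>2 * \<alpha> ^ Suc i\<close> of the next.\<close>

lemma not_critical_range_gap:
  assumes "2 \<le> \<alpha>" and "4 * \<alpha> ^ i \<le> w + 1" and "w < 2 * \<alpha> ^ Suc i"
  shows "\<not> critical_range \<alpha> w"
proof
  assume "critical_range \<alpha> w"
  then obtain j where j: "2 * \<alpha> ^ j \<le> w" "w \<le> 4 * \<alpha> ^ j - 2"
    by (auto simp: critical_range_def)
  have "1 \<le> \<alpha> ^ j" using assms(1) by simp
  show False
  proof (cases "j \<le> i")
    case True
    then have "\<alpha> ^ j \<le> \<alpha> ^ i" using assms(1) by (intro power_increasing) auto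
    then show False using j assms(2) \<open>1 \<le> \<alpha> ^ j\<close> by linarith
  next
    case False
    then have "\<alpha> ^ Suc i \<le> \<alpha> ^ j" using assms(1) by (intro power_less_imp_Suc_le) auto
    then show False using j assms(3) by linarith
  qed
qed

text \<open>The sibling clause could apply only at the last weight of the gap,
  \<open>2 * \<alpha> ^ Suc i - 1\<close>; the final premise excludes this case.\<close>

lemma not_critical_gap:
  assumes "2 \<le> \<alpha>" and "4 * \<alpha> ^ i \<le> w + 1" and "w < 2 * \<alpha> ^ Suc i"
    and "sib < 2 * \<alpha> ^ Suc i \<or> w + 1 < 2 * \<alpha> ^ Suc i"
  shows "\<not> critical \<alpha> w sib"
proof
  assume "critical \<alpha> w sib"
  then obtain j where j: "w = 2 * \<alpha> ^ j - 1" "sib = 2 * \<alpha> ^ j"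
    using not_critical_range_gap[OF assms(1-3)] by (auto simp: critical_def)
  have pos: "1 \<le> \<alpha> ^ j" "1 \<le> \<alpha> ^ i" "1 \<le> \<alpha> ^ Suc i" using assms(1) by simp_all
  consider "j \<le> i" | "j = Suc i" | "Suc i < j" by linarith
  then show False
  proof cases
    case 1
    then have "\<alpha> ^ j \<le> \<alpha> ^ i" using assms(1) by (intro power_increasing) auto
    then show False using j pos assms(2) by linarith
  next
    case 2
    then show False using j pos assms(4) by auto
  next
    case 3
    then have "\<alpha> ^ Suc (Suc i) \<le> \<alpha> ^ j" using assms(1) by (intro power_less_imp_Suc_le) auto
    moreover have "2 * \<alpha> ^ Suc i \<le> \<alpha> ^ Suc (Suc i)" using assms(1) by simp
    ultimately show False using j pos assms(3) by linarith
  qed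
qed

text \<open>At the lowest weight \<open>2 * \<alpha> ^ i - 1\<close> the sibling clause is needed: a
  parent weighing at least \<open>4 * \<alpha> ^ i - 1\<close> forces the sibling to weigh exactly
  \<open>2 * \<alpha> ^ i\<close>.\<close>

lemma critical_level:
  assumes "1 \<le> \<alpha>" and "2 * \<alpha> ^ i \<le> w + 1" and "w + 2 \<le> 4 * \<alpha> ^ i" and "4 * \<alpha> ^ i \<le> w + sib + 1"
    and "sib \<le> w + 1"
  shows "critical \<alpha> w sib"
proof (cases "w + 1 = 2 * \<alpha> ^ i")
  case True
  then have "w = 2 * \<alpha> ^ i - 1 \<and> sib = 2 * \<alpha> ^ i" using assms(4,5) by linarith
  then show ?thesis by (auto simp: critical_def)
next
  case False
  then have "2 * \<alpha> ^ i \<le> w \<and> w \<le> 4 * \<alpha> ^ i - 2" using assms(2,3) by linarith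
  then show ?thesis by (auto simp: critical_def critical_range_def)
qed

text \<open>Weights roughly halve at each step, and a range spans a factor of about two, so no path
  from above range \<open>i\<close> can jump over it. Until it enters the range, its weights below
  \<open>u\<close> stay in the gap and are not marked. The statement concerns the two children
  because the mark at the top is chosen by the caller.\<close>

lemma layered_label_tree:
  fixes u :: "'a tree"
  assumes "2 \<le> \<alpha>"
  shows "\<lbrakk>wbalanced u; u = \<langle>l, a, r\<rangle>; 4 * \<alpha> ^ i \<le> size1 u + 1; size1 u + 2 \<le> 4 * \<alpha> ^ Suc i\<rbrakk> \<Longrightarrow>
    layered \<alpha> (Suc i) (result (label_tree \<alpha> (critical \<alpha> (size1 l) (size1 r)) l)) \<and>
    layered \<alpha> (Suc i) (result (label_tree \<alpha> (critical \<alpha> (size1 r) (size1 l)) r))"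
proof (induction "size u" arbitrary: u l a r i rule: less_induct)
  case less
  have child: "layered \<alpha> (Suc i) (result (label_tree \<alpha> (critical \<alpha> (size1 v) (size1 v')) v))"
    if v: "wbalanced v" "size v < size u" "size1 v + size1 v' = size1 u" "size1 v' \<le> size1 v + 1"
      "size1 v \<le> size1 v' + 1" for v v' :: "'a tree"
  proof (cases "size1 v + 2 \<le> 4 * \<alpha> ^ i")
    case True
    \<comment> \<open>First entry into range \<open>i\<close>: half of a parent weight of at least
      \<open>4 * \<alpha> ^ i - 1\<close> cannot fall below the range.\<close>
    have lo: "2 * \<alpha> ^ i \<le> size1 v + 1"
      using v less.prems(3) by linarith
    then have crit: "critical \<alpha> (size1 v) (size1 v')"
      using True v less.prems assms by (intro critical_level[of \<alpha> i]) auto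
    show ?thesis
    proof (cases v)
      case Leaf
      then have "\<alpha> ^ i \<le> 1" using lo by simp
      moreover have "2 \<le> \<alpha> ^ i" if "i > 0"
        using assms power_less_imp_Suc_le[OF assms that] by simp
      ultimately show ?thesis using Leaf by (cases i) auto
    next
      case (Node vl b vr)
      have "layered \<alpha> i (result (label_tree \<alpha> (critical \<alpha> (size1 vl) (size1 vr)) vl)) \<and>
            layered \<alpha> i (result (label_tree \<alpha> (critical \<alpha> (size1 vr) (size1 vl)) vr))"
      proof (cases i)
        case 0
        then show ?thesis using True Node by (simp add: size1_eq)
      next
        case (Suc i')
        \<comment> \<open>With \<open>2 \<le> \<alpha>\<close>, a node in range \<open>i\<close> is
          already above range \<open>i - 1\<close>, so the induction hypothesis applies one level
          lower.\<close>
        have "4 * \<alpha> ^ i' \<le> 2 * \<alpha> ^ i" using assms Suc by simp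
        then have "4 * \<alpha> ^ i' \<le> size1 v + 1" using lo by linarith
        then show ?thesis
          using less.hyps[OF v(2,1) Node, of i'] True Suc by simp
      qed
      moreover have "2 \<le> size1 v" using Node by (simp add: size1_eq)
      ultimately show ?thesis
        using lo True crit Node by (simp add: Let_def)
    qed
  next
    case False
    then have lo: "4 * \<alpha> ^ i \<le> size1 v + 1" by linarith
    have "\<not> critical \<alpha> (size1 v) (size1 v')"
      \<comment> \<open>The weight of \<open>u\<close> is at most
        \<open>4 * \<alpha> ^ Suc i - 2\<close>, so balance keeps both children below
        \<open>2 * \<alpha> ^ Suc i\<close>.\<close>
      using v less.prems lo by (intro not_critical_gap[OF assms lo]) linarith+
    moreover have "1 \<le> \<alpha> ^ i" using assms by simp
    with lo obtain vl b vr where Node: "v = \<langle>vl, b, vr\<rangle>"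
      by (cases v) auto
    moreover have "layered \<alpha> (Suc i) (result (label_tree \<alpha> (critical \<alpha> (size1 vl) (size1 vr)) vl)) \<and>
            layered \<alpha> (Suc i) (result (label_tree \<alpha> (critical \<alpha> (size1 vr) (size1 vl)) vr))"
      using less.prems v by (intro less.hyps[OF v(2,1) Node lo]) linarith
    ultimately show ?thesis by (simp add: Let_def)
  qed
  show ?case
    using less.prems(1,2) by (intro conjI child) (auto simp: size1_eq)
qed

lemma root_layered_label_tree:
  assumes "2 \<le> \<alpha>" and "wbalanced u"
  shows "root_layered \<alpha> (result (label_tree \<alpha> True u))"
proof (cases u)
  case (Node l a r)
  \<comment> \<open>The least such \<open>L\<close> is the level demanded by
    \<open>root_layered\<close>; the exponent \<open>size1 u + 2\<close> witnesses
    existence.\<close>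
  define L where "L = (LEAST L. size1 u + 2 \<le> 4 * \<alpha> ^ L)"
  have "size1 u + 2 < \<alpha> ^ (size1 u + 2)"
    using assms(1) by (intro power_gt_expt) auto
  then have "size1 u + 2 \<le> 4 * \<alpha> ^ (size1 u + 2)" by linarith
  then have hi: "size1 u + 2 \<le> 4 * \<alpha> ^ L"
    unfolding L_def by (rule LeastI)
  have lo: "4 * \<alpha> ^ i \<le> size1 u + 1" if "L = Suc i" for i
    using not_less_Least[of i "\<lambda>L. size1 u + 2 \<le> 4 * \<alpha> ^ L"] that
    unfolding L_def[symmetric] by simp
  have "layered \<alpha> L (result (label_tree \<alpha> (critical \<alpha> (size1 l) (size1 r)) l)) \<and>
        layered \<alpha> L (result (label_tree \<alpha> (critical \<alpha> (size1 r) (size1 l)) r))"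
  proof (cases L)
    case 0
    then show ?thesis using hi Node by (simp add: size1_eq)
  next
    case (Suc i)
    then show ?thesis
      using layered_label_tree[OF assms Node lo[OF Suc]] hi by simp
  qed
  moreover have "2 \<le> size1 u" using Node by (simp add: size1_eq)
  ultimately show ?thesis
    using hi lo Node by (auto simp: Let_def intro!: exI[of _ L])
qed simp

text \<open>Doubling leaves range \<open>i\<close> except from its lowest weight
  \<open>2 * \<alpha> ^ i - 1\<close>, where \<open>2 * s\<close> is the top of the range. All
  larger doubled weights are either in the gap above or reach the next range, where the exception
  clause forbids the mark.\<close>

lemma marks_new_root_iff:
  assumes "2 \<le> \<alpha>" and "2 * \<alpha> ^ i \<le> s + 1" and "s + 2 \<le> 4 * \<alpha> ^ i"
  shows "marks_new_root \<alpha> s \<longleftrightarrow> s + 1 = 2 * \<alpha> ^ i"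
proof
  assume "s + 1 = 2 * \<alpha> ^ i"
  have pos: "1 \<le> \<alpha> ^ i" using assms(1) by simp
  have "2 * \<alpha> ^ i \<le> 2 * s \<and> 2 * s \<le> 4 * \<alpha> ^ i - 2"
    using \<open>s + 1 = _\<close> pos by linarith
  then have "critical_range \<alpha> (2 * s)"
    by (auto simp: critical_range_def)
  moreover have False if "s \<le> 4 * \<alpha> ^ j - 2" "2 * \<alpha> ^ (j + 1) - 1 \<le> 2 * s" for j
  proof (cases "j < i")
    case True
    then have "\<alpha> ^ Suc j \<le> \<alpha> ^ i" by (intro power_less_imp_Suc_le assms)
    moreover have "2 * \<alpha> ^ j \<le> \<alpha> ^ Suc j" using assms(1) by simp
    moreover have "1 \<le> \<alpha> ^ j" using assms(1) by simp
    ultimately show False using that(1) \<open>s + 1 = _\<close> by linarith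
  next
    case False
    then have "\<alpha> ^ Suc i \<le> \<alpha> ^ (j + 1)" using assms(1) by (intro power_increasing) auto
    moreover have "2 * \<alpha> ^ i \<le> \<alpha> ^ Suc i" using assms(1) by simp
    ultimately show False using that(2) \<open>s + 1 = _\<close> pos by linarith
  qed
  ultimately show "marks_new_root \<alpha> s"
    by (auto simp: marks_new_root_def)
next
  assume mark: "marks_new_root \<alpha> s"
  show "s + 1 = 2 * \<alpha> ^ i"
  proof (rule ccontr)
    assume "s + 1 \<noteq> 2 * \<alpha> ^ i"
    then have lo: "4 * \<alpha> ^ i \<le> 2 * s + 1" using assms(2) by linarith
    have "s \<le> 4 * \<alpha> ^ i - 2" using assms(3) by linarith
    then have "\<not> 2 * \<alpha> ^ (i + 1) - 1 \<le> 2 * s"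
      using mark unfolding marks_new_root_def by blast
    then have "2 * s < 2 * \<alpha> ^ Suc i" by simp
    then show False
      using not_critical_range_gap[OF assms(1) lo] mark by (auto simp: marks_new_root_def)
  qed
qed

text \<open>If the new root is marked, it is itself the node of level \<open>i\<close> and its
  children supply the lower levels. If not, its weight is above range \<open>i\<close>, so the
  labeling of the balanced subtree supplies level \<open>i\<close> below it.\<close>

lemma layered_rebuilt:
  assumes "2 \<le> \<alpha>" and "2 * \<alpha> ^ i \<le> s + 1" and "s + 2 \<le> 4 * \<alpha> ^ i" and "2 \<le> s"
    and "wbalanced u" and "size1 u = 2 * s"
  shows "layered \<alpha> (Suc i) (result (label_tree \<alpha> (marks_new_root \<alpha> s) u))"
proof -
  obtain l a r where u: "u = \<langle>l, a, r\<rangle>"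
    using assms(4,6) by (cases u) auto
  have pos: "1 \<le> \<alpha> ^ i" using assms(1) by simp
  show ?thesis
  proof (cases "s + 1 = 2 * \<alpha> ^ i")
    case True
    then obtain i' where i: "i = Suc i'"
      using assms(4) by (cases i) auto
    have "2 * \<alpha> ^ i' \<le> \<alpha> ^ i" using assms(1) i by simp
    then have "4 * \<alpha> ^ i' \<le> size1 u + 1" using True assms(6) pos by linarith
    then have "layered \<alpha> i (result (label_tree \<alpha> (critical \<alpha> (size1 l) (size1 r)) l)) \<and>
      layered \<alpha> i (result (label_tree \<alpha> (critical \<alpha> (size1 r) (size1 l)) r))"
      using layered_label_tree[OF assms(1,5) u, of i'] True assms(6) i by simp
    then show ?thesis
      using True marks_new_root_iff[OF assms(1-3)] assms(4,6) u by (simp add: Let_def)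
  next
    case False
    have "2 * \<alpha> ^ i \<le> \<alpha> ^ Suc i" using assms(1) by simp
    then have "size1 u + 2 \<le> 4 * \<alpha> ^ Suc i" "4 * \<alpha> ^ i \<le> size1 u + 1"
      using False assms(2,3,6) by linarith+
    then show ?thesis
      using layered_label_tree[OF assms(1,5) u] False marks_new_root_iff[OF assms(1-3)] u
      by (simp add: Let_def)
  qed
qed

section \<open>Building and flattening\<close>

abbreviation items :: "'k ltree \<Rightarrow> 'k item list" where
  "items t \<equiv> map fst (inorder t)"

abbreviation keys :: "'k ltree \<Rightarrow> 'k tree" where
  "keys t \<equiv> map_tree (\<lambda>p. fst (fst p)) t"

lemma length_items: "length (items t) = size t"
  by simp

lemma bst_keys_iff: "bst (keys t) \<longleftrightarrow> sorted_wrt (<) (map fst (items t))"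
  by (simp add: bst_iff_sorted_wrt_less inorder_map comp_def)

lemma flatten_simps:
  "result (flatten t) = items t"
  "work \<omega> (flatten t) = real (2 * size t + 1) + \<omega> * real (size t)"
  by (simp_all add: flatten_def)

context
  fixes K \<omega> :: real and build :: "('k :: linorder) builder" and \<alpha> :: nat
  assumes build: "rebuilder K \<omega> build" and \<alpha>: "2 \<le> \<alpha>" and \<omega>: "1 \<le> \<omega>"
begin

lemma build_labeled:
  assumes "sorted_wrt (<) (map fst xs)"
  shows "items (result (build_labeled \<alpha> build c xs)) = xs"
    and "size (result (build_labeled \<alpha> build c xs)) = length xs"
    and "slack (result (build_labeled \<alpha> build c xs)) = 0"
    and "work \<omega> (build_labeled \<alpha> build c xs) \<le>
           K * \<omega> * real (length xs + 1) + (2 + \<omega>) * real (length xs)"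
    and "root_layered \<alpha> (result (build_labeled \<alpha> build True xs))"
proof -
  have u: "inorder (result (build xs)) = xs" "wbalanced (result (build xs))"
    "work \<omega> (build xs) \<le> K * \<omega> * real (length xs + 1)"
    using build assms unfolding rebuilder_def by auto
  then have len: "size (result (build xs)) = length xs"
    by (metis length_inorder)
  show "items (result (build_labeled \<alpha> build c xs)) = xs"
    "size (result (build_labeled \<alpha> build c xs)) = length xs"
    "slack (result (build_labeled \<alpha> build c xs)) = 0"
    by (simp_all add: build_labeled_def u len)
  show "work \<omega> (build_labeled \<alpha> build c xs) \<le>
           K * \<omega> * real (length xs + 1) + (2 + \<omega>) * real (length xs)"
    using work_label_tree[of \<omega> \<alpha> c "result (build xs)"] u(3) \<omega> len
    by (simp add: build_labeled_def)
  show "root_layered \<alpha> (result (build_labeled \<alpha> build True xs))"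
    using root_layered_label_tree[OF \<alpha> u(2)] by (simp add: build_labeled_def)
qed

lemma layered_build_labeled:
  assumes "sorted_wrt (<) (map fst xs)" and "length xs + 1 = 2 * s"
    and "2 * \<alpha> ^ i \<le> s + 1" and "s + 2 \<le> 4 * \<alpha> ^ i" and "2 \<le> s"
  shows "layered \<alpha> (Suc i) (result (build_labeled \<alpha> build (marks_new_root \<alpha> s) xs))"
proof -
  have u: "inorder (result (build xs)) = xs" "wbalanced (result (build xs))"
    using build assms(1) unfolding rebuilder_def by auto
  then have "size1 (result (build xs)) = 2 * s"
    using assms(2) length_inorder[of "result (build xs)"] by (simp add: size1_eq)
  then show ?thesis
    using layered_rebuilt[OF \<alpha> assms(3-5) u(2)] by (simp add: build_labeled_def)
qed

end

section \<open>Searching and marking\<close>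

lemma work_lookup: "work \<omega> (lookup x t) \<le> 2 * real (height t) + 1"
  by (induction x t rule: lookup.induct) auto

lemma lookup_None: "bst (keys t) \<Longrightarrow> result (lookup x t) = None \<Longrightarrow> x \<notin> set_tree (keys t)"
  by (induction x t rule: lookup.induct) (auto split: if_splits)

lemma work_set_mark: "0 \<le> \<omega> \<Longrightarrow> work \<omega> (set_mark x b t) \<le> 2 * real (height t) + 1 + \<omega>"
  by (induction x b t rule: set_mark.induct) auto

lemma keys_set_mark [simp]: "keys (result (set_mark x b t)) = keys t"
  by (induction x b t rule: set_mark.induct) auto

lemma labels_set_mark [simp]: "map_tree snd (result (set_mark x b t)) = map_tree snd t"
  by (induction x b t rule: set_mark.induct) auto

lemma size_set_mark [simp]: "size (result (set_mark x b t)) = size t"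
  by (metis labels_set_mark size_map_tree)

lemma slack_set_mark [simp]: "slack (result (set_mark x b t)) = slack t"
  by (induction x b t rule: set_mark.induct) auto

lemma layered_set_mark: "layered \<alpha> i t \<Longrightarrow> layered \<alpha> i (result (set_mark x b t))"
proof (induction x b t arbitrary: i rule: set_mark.induct)
  case (2 x b l k d lb r)
  show ?case
  proof (cases i)
    case (Suc j)
    then show ?thesis
      using 2 by (cases lb) (auto simp: size1_eq)
  qed (use 2 in simp)
qed simp

lemma root_layered_set_mark:
  "root_layered \<alpha> t \<Longrightarrow> root_layered \<alpha> (result (set_mark x b t))"
proof (induction x b t rule: set_mark.induct)
  case (2 x b l k d lb r)
  then show ?case
    by (auto simp: size1_eq intro!: layered_set_mark)
qed simp

definition marked :: "'k ltree \<Rightarrow> nat" where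
  "marked t = length (filter snd (items t))"

lemma marked_simps [simp]:
  "marked \<langle>\<rangle> = 0"
  "marked \<langle>l, ((k, d), lb), r\<rangle> = marked l + (if d then 1 else 0) + marked r"
  by (simp_all add: marked_def)

lemma marked_set_mark:
  "result (lookup x t) = Some False \<Longrightarrow> marked (result (set_mark x True t)) = Suc (marked t)"
  "result (lookup x t) = Some True \<Longrightarrow> Suc (marked (result (set_mark x False t))) = marked t"
  by (induction x t rule: lookup.induct) (auto split: if_splits)

lemma num_objects_eq:
  fixes t :: "('a :: linorder) ltree"
  shows "num_objects (t, dead) + marked t = size t"
proof -
  have "(\<lambda>((_, d), _). \<not> d) = (\<lambda>p :: ('a \<times> bool) \<times> label. \<not> snd (fst p))"
    by auto
  then have "num_objects (t, dead) = length (filter (\<lambda>p. \<not> snd p) (items t))"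
    by (simp add: num_objects_def filter_map comp_def)
  then show ?thesis
    unfolding marked_def using sum_length_filter_compl[of snd "items t"]
    by (simp add: length_items del: length_map)
qed

lemma root_weight_root_layered: "root_layered \<alpha> t \<Longrightarrow> root_weight t = size1 t"
  by (cases t rule: root_weight.cases) auto

section \<open>Insertion and rebuilding\<close>

lemma size_grow [simp]: "size (result (grow x t)) = Suc (size t)"
  by (induction x t rule: grow.induct) (auto split: option.splits)

lemma size1_grow [simp]: "size1 (result (grow x t)) = Suc (size1 t)"
  by (simp add: size1_eq)

lemma height_grow: "height (result (grow x t)) \<le> Suc (height t)"
  by (induction x t rule: grow.induct) (auto split: option.splits)

text \<open>Each critical node on the search path gains one unit; the new leaf has equal initial and
  current weight and adds none.\<close>

lemma slack_grow: "slack (result (grow x t)) \<le> slack t + crit_height t"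
  by (induction x t rule: grow.induct) (auto split: option.splits)

lemma work_grow:
  "0 \<le> \<omega> \<Longrightarrow> work \<omega> (grow x t) \<le> 2 * real (height t) + 1 + \<omega> * (real (crit_height t) + 2)"
proof (induction x t rule: grow.induct)
  case (2 x l k d lb r)
  have "\<omega> * real (crit_height l) \<le> \<omega> * real (max (crit_height l) (crit_height r))"
       "\<omega> * real (crit_height r) \<le> \<omega> * real (max (crit_height l) (crit_height r))"
    using 2(3) by (intro mult_left_mono; simp)+
  then show ?case
    using 2 by (auto simp: algebra_simps of_nat_max split: option.splits)
qed auto

lemma set_keys_grow [simp]: "set_tree (keys (result (grow x t))) = insert x (set_tree (keys t))"
  by (induction x t rule: grow.induct) (auto split: option.splits)

lemma bst_grow: "bst (keys t) \<Longrightarrow> x \<notin> set_tree (keys t) \<Longrightarrow> bst (keys (result (grow x t)))"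
  by (induction x t rule: grow.induct) (auto split: option.splits)

lemma marked_grow [simp]: "marked (result (grow x t)) = marked t"
  by (induction x t rule: grow.induct) (auto split: option.splits)

text \<open>Naming the test in \<open>repair\<close> lets its equation be split into one lemma per
  outcome instead of being unfolded as a whole.\<close>

definition due :: "label \<Rightarrow> bool" where
  "due lb \<longleftrightarrow> (case lb of None \<Rightarrow> False | Some (s, w) \<Rightarrow> 2 * s \<le> w)"

lemma due_simps [simp]: "\<not> due None" "due (Some (s, w)) \<longleftrightarrow> 2 * s \<le> w"
  by (simp_all add: due_def)

lemma repair_due:
  assumes "due lb" and "t = \<langle>l, ((k, d), lb), r\<rangle>"
    and "b = build_labeled \<alpha> build (at_root \<or> marks_new_root \<alpha> (fst (the lb))) (items t)"
  shows "result (repair \<alpha> build at_root x t) = result b"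
    and "work \<omega> (repair \<alpha> build at_root x t) =
      real (2 * size t + 3) + \<omega> * real (size t + 1) + work \<omega> b"
  using assms(1) unfolding assms(2,3)
  by (simp_all add: due_def flatten_simps algebra_simps)

lemma repair_not_due:
  assumes "\<not> due lb"
  shows "repair \<alpha> build at_root x \<langle>l, ((k, d), lb), r\<rangle> = do {
    tick 2;
    if x < k then do { l' \<leftarrow> repair \<alpha> build False x l; ret \<langle>l', ((k, d), lb), r\<rangle> }
    else if k < x then do { r' \<leftarrow> repair \<alpha> build False x r; ret \<langle>l, ((k, d), lb), r'\<rangle> }
    else ret \<langle>l, ((k, d), lb), r\<rangle> }"
  using assms by (simp add: due_def)

declare repair.simps(2) [simp del]

section \<open>Amortized analysis of growing and repairing\<close>

context
  fixes K \<omega> B :: real and build :: "('k :: linorder) builder" and \<alpha> :: nat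
  assumes build: "rebuilder K \<omega> build" and \<alpha>: "2 \<le> \<alpha>" and \<omega>: "1 \<le> \<omega>" and K: "0 < K"
    and B: "B = 2 * (6 + K) * \<omega>"
begin

lemmas built = build_labeled[OF build \<alpha> \<omega>]

lemma items_repair: "bst (keys t) \<Longrightarrow> items (result (repair \<alpha> build at_root x t)) = items t"
proof (induction t arbitrary: at_root)
  case (Node l p r)
  obtain k d lb where p: "p = ((k, d), lb)" by (metis surj_pair)
  show ?case
  proof (cases "due lb")
    case True
    show ?thesis
      using Node.prems unfolding repair_due(1)[OF True arg_cong[of p _ "\<lambda>p. \<langle>l, p, r\<rangle>", OF p] refl]
        bst_keys_iff by (rule built(1))
  next
    case False
    then show ?thesis
      using Node by (simp add: p repair_not_due)
  qed
qed simp

text \<open>A doubled node has slack \<open>s\<close>, and its \<open>2 * s - 1\<close> descendants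
  including itself are rebuilt. Flattening and labeling cost at most \<open>6 * \<omega>\<close> per
  node and construction \<open>K * \<omega>\<close> per unit of weight, so
  \<open>B = 2 * (6 + K) * \<omega>\<close> per unit of slack suffices. The fresh subtree has slack
  0.\<close>

lemma amortized_repair_due:
  assumes t: "t = \<langle>l, ((k, d), Some (s, w)), r\<rangle>" and w: "size1 t = w" "w = 2 * s"
    and "bst (keys t)"
  shows "work \<omega> (repair \<alpha> build at_root x t) + B * real (slack (result (repair \<alpha> build at_root x t)))
    \<le> 2 * real (height t) + 1 + B * real (slack t)"
proof -
  have due: "due (Some (s, w))" using w by simp
  define b where "b = build_labeled \<alpha> build
    (at_root \<or> marks_new_root \<alpha> (fst (the (Some (s, w))))) (items t)"
  have sorted: "sorted_wrt (<) (map fst (items t))"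
    using assms(4) bst_keys_iff by blast
  note b = built(3,4)[OF sorted, folded b_def, of "at_root \<or> marks_new_root \<alpha> (fst (the (Some (s, w))))",
      folded b_def, unfolded length_items]
  note rep = repair_due[OF due t b_def, where x = x]
  have sz: "real (size t) = 2 * real s - 1"
    using w by (simp add: size1_eq)
  have s: "1 \<le> real s" using sz by simp
  have "work \<omega> (repair \<alpha> build at_root x t) \<le>
      3 + 4 * real (size t) + \<omega> * (2 * real (size t) + 1 + K * (real (size t) + 1))"
    using b(2) unfolding rep(2) by (simp add: algebra_simps)
  also have "\<dots> \<le> 3 + \<omega> * (4 * real (size t)) + \<omega> * (2 * real (size t) + 1 + K * (real (size t) + 1))"
    using mult_right_mono[OF \<omega>, of "4 * real (size t)"] by simp
  also have "\<dots> = 3 + B * real s - 5 * \<omega>"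
    by (simp add: B sz algebra_simps)
  also have "\<dots> \<le> 3 + B * real s" using \<omega> by simp
  also have "\<dots> \<le> 3 + B * real (slack t)"
  proof -
    have "s \<le> slack t" using t w by simp
    moreover have "0 \<le> B" using B K \<omega> by simp
    ultimately show ?thesis by (simp add: mult_left_mono)
  qed
  also have "3 \<le> 2 * real (height t) + 1" using t by simp
  finally show ?thesis using b(1) by (simp add: rep(1))
qed

text \<open>The one node passed costs 2, paid by one level of height; the slack outside the chosen
  child does not change.\<close>

lemma amortized_repair_not_due:
  assumes "\<not> due lb"
    and "x < k \<Longrightarrow> work \<omega> (repair \<alpha> build False x l) + B * real (slack (result (repair \<alpha> build False x l)))
      \<le> 2 * real (height l) + 1 + B * real (slack l)"
    and "k < x \<Longrightarrow> work \<omega> (repair \<alpha> build False x r) + B * real (slack (result (repair \<alpha> build False x r)))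
      \<le> 2 * real (height r) + 1 + B * real (slack r)"
    and "t = \<langle>l, ((k, d), lb), r\<rangle>"
  shows "work \<omega> (repair \<alpha> build at_root x t) + B * real (slack (result (repair \<alpha> build at_root x t)))
    \<le> 2 * real (height t) + 1 + B * real (slack t)"
  using assms(2,3) unfolding assms(4) repair_not_due[OF assms(1)]
  by (auto simp: algebra_simps of_nat_max)

lemma size1_repair [simp]:
  "bst (keys t) \<Longrightarrow> size1 (result (repair \<alpha> build at_root x t)) = size1 t"
  using arg_cong[OF items_repair, of t length at_root x] by (simp add: size1_eq)

text \<open>Both passes are treated together, since after \<open>grow\<close> alone a doubled node
  violates \<open>w < 2 * s\<close>. At level 0 only the empty tree may grow without exceeding one
  node.\<close>

lemma insert_layered:
  assumes "layered \<alpha> i t" and "i = 0 \<Longrightarrow> t = \<langle>\<rangle>" and "bst (keys t)" and "x \<notin> set_tree (keys t)"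
  shows "layered \<alpha> i (result (repair \<alpha> build False x (result (grow x t)))) \<and>
    work \<omega> (repair \<alpha> build False x (result (grow x t))) +
      B * real (slack (result (repair \<alpha> build False x (result (grow x t)))))
    \<le> 2 * real (height (result (grow x t))) + 1 + B * real (slack (result (grow x t)))"
  using assms
proof (induction t arbitrary: i)
  case Leaf
  show ?case
    by (cases i) (use Leaf in \<open>auto simp: repair_not_due\<close>)
next
  case (Node l p r)
  obtain k d lb where p: "p = ((k, d), lb)" by (metis surj_pair)
  obtain j where i: "i = Suc j" using Node.prems(2) by (cases i) auto
  have bst: "bst (keys l)" "bst (keys r)" and x: "x \<noteq> k" "x \<notin> set_tree (keys l)" "x \<notin> set_tree (keys r)"
    using Node.prems(3,4) p by auto
  have bst': "bst (keys (result (grow x l)))" "bst (keys (result (grow x r)))"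
    using bst x by (auto intro: bst_grow)
  let ?t = "result (grow x \<langle>l, p, r\<rangle>)"
  show ?case
  proof (cases lb)
    case None
    have lay: "layered \<alpha> i l" "layered \<alpha> i r"
      using Node.prems(1) p None i by auto
    note IH = Node.IH(1)[OF lay(1) _ bst(1) x(2)] Node.IH(2)[OF lay(2) _ bst(2) x(3)]
    show ?thesis
    proof
      show "layered \<alpha> i (result (repair \<alpha> build False x ?t))"
        using IH lay x(1) i None by (auto simp: p repair_not_due)
      \<comment> \<open>The conditional subtrees describe the grown tree for either search
        direction, so one instance covers both.\<close>
      show "work \<omega> (repair \<alpha> build False x ?t) + B * real (slack (result (repair \<alpha> build False x ?t)))
        \<le> 2 * real (height ?t) + 1 + B * real (slack ?t)"
        by (rule amortized_repair_not_due[of None x k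
              "if x < k then result (grow x l) else l" "if x < k then r else result (grow x r)"])
          (use IH i x(1) None in \<open>auto simp: p\<close>)
    qed
  next
    case (Some sw)
    obtain s w where sw: "sw = (s, w)" by (cases sw)
    have *: "2 * \<alpha> ^ j \<le> s + 1" "s + 2 \<le> 4 * \<alpha> ^ j" "s \<le> w" "w < 2 * s" "w = size1 l + size1 r"
      "layered \<alpha> j l" "layered \<alpha> j r"
      using Node.prems(1) p Some sw i by auto
    obtain l' r' where t': "?t = \<langle>l', ((k, d), Some (s, w + 1)), r'\<rangle>"
      by (cases "x < k") (auto simp: p Some sw)
    have w': "size1 ?t = w + 1" by (simp add: size1_eq *(5))
    have bst_t: "bst (keys ?t)" by (rule bst_grow[OF Node.prems(3,4)])
    show ?thesis
    proof (cases "2 * s = w + 1")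
      case True
      then have due: "due (Some (s, w + 1))" by simp
      have "2 \<le> s" using True * by (simp add: size1_eq)
      moreover have "length (items ?t) + 1 = 2 * s"
        using w' True by (simp add: size1_eq del: grow.simps)
      ultimately have "layered \<alpha> i (result (repair \<alpha> build False x ?t))"
        using * bst_t i
        by (subst repair_due(1)[OF due t' refl])
          (auto simp: bst_keys_iff intro!: layered_build_labeled[OF build \<alpha> \<omega>] simp del: grow.simps)
      with amortized_repair_due[OF t' w' _ bst_t] True show ?thesis by simp
    next
      case False
      then have nd: "\<not> due (Some (s, w + 1))" using *(4) by simp
      \<comment> \<open>At level 0 the bounds force \<open>s = 2\<close>. A weight of 3 would become
        due now, so the weight is 2 and both children are empty.\<close>
      have leaf: "l = \<langle>\<rangle> \<and> r = \<langle>\<rangle>" if "j = 0"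
        using that False * by (cases l; cases r) (auto simp: size1_eq)
      note IH = Node.IH(1)[OF *(6) _ bst(1) x(2)] Node.IH(2)[OF *(7) _ bst(2) x(3)]
      show ?thesis
      proof
        show "layered \<alpha> i (result (repair \<alpha> build False x ?t))"
          using IH leaf * x(1) i Some sw False nd bst'
          by (auto simp: p repair_not_due)
        show "work \<omega> (repair \<alpha> build False x ?t) + B * real (slack (result (repair \<alpha> build False x ?t)))
          \<le> 2 * real (height ?t) + 1 + B * real (slack ?t)"
          by (rule amortized_repair_not_due[OF nd, of x k
              "if x < k then result (grow x l) else l" "if x < k then r else result (grow x r)"])
            (use IH leaf x(1) Some sw in \<open>auto simp: p\<close>)
      qed
    qed
  qed
qed

text \<open>The root is always marked again when rebuilt, at whatever level its new weight dictates;
  otherwise \<open>L\<close> is unchanged and the child is handled by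
  \<open>insert_layered\<close>.\<close>

lemma insert_root_layered:
  assumes "root_layered \<alpha> t" and "bst (keys t)" and "x \<notin> set_tree (keys t)"
  shows "root_layered \<alpha> (result (repair \<alpha> build True x (result (grow x t)))) \<and>
    work \<omega> (repair \<alpha> build True x (result (grow x t))) +
      B * real (slack (result (repair \<alpha> build True x (result (grow x t)))))
    \<le> 2 * real (height (result (grow x t))) + 1 + B * real (slack (result (grow x t)))"
proof (cases t)
  case Leaf
  then show ?thesis
    by (auto simp: repair_not_due intro!: exI[of _ 0])
next
  case (Node l p r)
  obtain k d lb where p: "p = ((k, d), lb)" by (metis surj_pair)
  have bst: "bst (keys l)" "bst (keys r)" and x: "x \<noteq> k" "x \<notin> set_tree (keys l)" "x \<notin> set_tree (keys r)"
    using assms(2,3) p Node by auto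
  have bst': "bst (keys (result (grow x l)))" "bst (keys (result (grow x r)))"
    using bst x by (auto intro: bst_grow)
  let ?t = "result (grow x t)"
  obtain s w L where lb: "lb = Some (s, w)"
    and *: "s \<le> w" "w < 2 * s" "w = size1 l + size1 r" "s + 2 \<le> 4 * \<alpha> ^ L"
      "\<And>i. L = Suc i \<Longrightarrow> 4 * \<alpha> ^ i \<le> s + 1" "layered \<alpha> L l" "layered \<alpha> L r"
    using assms(1) by (auto simp: Node p)
  obtain l' r' where t': "?t = \<langle>l', ((k, d), Some (s, w + 1)), r'\<rangle>"
    by (cases "x < k") (auto simp: p Node lb)
  have w': "size1 ?t = w + 1" by (simp add: size1_eq *(3) Node)
  have bst_t: "bst (keys ?t)" by (rule bst_grow[OF assms(2,3)])
  show ?thesis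
  proof (cases "2 * s = w + 1")
    case True
    then have due: "due (Some (s, w + 1))" by simp
    have "root_layered \<alpha> (result (repair \<alpha> build True x ?t))"
      using bst_t by (subst repair_due(1)[OF due t' refl])
        (auto simp: bst_keys_iff intro!: built(5))
    with amortized_repair_due[OF t' w' _ bst_t] True show ?thesis by simp
  next
    case False
    then have nd: "\<not> due (Some (s, w + 1))" using *(2) by simp
    have leaf: "l = \<langle>\<rangle> \<and> r = \<langle>\<rangle>" if "L = 0"
      using that False * by (cases l; cases r) (auto simp: size1_eq)
    note child = insert_layered[OF *(6) _ bst(1) x(2)] insert_layered[OF *(7) _ bst(2) x(3)]
    have lay: "x < k \<Longrightarrow> layered \<alpha> L (result (repair \<alpha> build False x (result (grow x l))))"
        "\<not> x < k \<Longrightarrow> layered \<alpha> L (result (repair \<alpha> build False x (result (grow x r))))"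
      using child leaf by auto
    show ?thesis
    proof
      show "root_layered \<alpha> (result (repair \<alpha> build True x ?t))"
        using lay * x(1) lb False nd bst'
        by (auto simp: p Node repair_not_due intro!: exI[of _ L])
      show "work \<omega> (repair \<alpha> build True x ?t) + B * real (slack (result (repair \<alpha> build True x ?t)))
        \<le> 2 * real (height ?t) + 1 + B * real (slack ?t)"
        by (rule amortized_repair_not_due[OF nd, of x k
            "if x < k then result (grow x l) else l" "if x < k then r else result (grow x r)"])
          (use child leaf x(1) lb in \<open>auto simp: p Node\<close>)
    qed
  qed
qed

end
section \<open>The state invariant and the potential\<close>

lemma log_inverse_nonneg:
  fixes \<delta> :: real
  assumes "0 < \<delta>" and "\<delta> < 1"
  shows "0 \<le> log 2 (1 / (1 - \<delta>))"
  using assms by (subst zero_le_log_cancel_iff) auto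

lemma marked_eqI: "items t = items t' \<Longrightarrow> marked t = marked t'"
  by (simp add: marked_def)

definition invar :: "real \<Rightarrow> nat \<Rightarrow> ('k :: linorder) state \<Rightarrow> bool" where
  "invar \<delta> \<alpha> S \<longleftrightarrow> root_layered \<alpha> (fst S) \<and> bst (keys (fst S)) \<and> snd S = marked (fst S) \<and>
     real (snd S) \<le> \<delta> * real (size (fst S))"

definition potential :: "real \<Rightarrow> real \<Rightarrow> 'k state \<Rightarrow> real" where
  "potential B D S = B * real (slack (fst S)) + D * real (snd S)"

context
  fixes K \<omega> B D \<delta> :: real and build :: "('k :: linorder) builder" and \<alpha> :: nat
  assumes build: "rebuilder K \<omega> build" and \<alpha>: "2 \<le> \<alpha>" and \<omega>: "1 \<le> \<omega>" and K: "0 < K"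
    and B: "B = 2 * (6 + K) * \<omega>" and D: "D = (6 + K) / \<delta> * \<omega>" and \<delta>: "0 < \<delta>"
begin

text \<open>Three passes, the last on a tree one level higher, give \<open>6 * height + 5\<close>.
  The \<open>\<omega>\<close> term covers the writes of \<open>grow\<close> and the part of a global
  rebuild independent of the size. The terms in \<open>B\<close> and \<open>D\<close> cover the new
  slack and one new mark.\<close>

abbreviation op_bound :: "'k state \<Rightarrow> real" where
  "op_bound S \<equiv> 6 * real (height (fst S)) + 5 + \<omega> * (real (crit_height (fst S)) + 5 + K) +
     B * real (crit_height (fst S)) + D"

section \<open>Amortized bounds for single updates\<close>

lemma B_D_nonneg: "0 \<le> B" "0 \<le> D"
  using B D K \<omega> \<delta> by simp_all

text \<open>In order: a search that changes nothing, the unmarking of an object, and a deletion that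
  takes effect.\<close>

lemma op_bound_ge: "2 * real (height (fst S)) + 1 \<le> op_bound S"
  "4 * real (height (fst S)) + 2 + 2 * \<omega> \<le> op_bound S"
  "4 * real (height (fst S)) + 3 + \<omega> * (5 + K) + D \<le> op_bound S"
proof -
  show *: "4 * real (height (fst S)) + 3 + \<omega> * (5 + K) + D \<le> op_bound S"
    using B_D_nonneg \<omega> by (simp add: algebra_simps)
  have "2 * \<omega> \<le> \<omega> * (5 + K)" "0 \<le> \<omega> * (5 + K)"
    using \<omega> K by (simp_all add: algebra_simps)
  then show "4 * real (height (fst S)) + 2 + 2 * \<omega> \<le> op_bound S"
    "2 * real (height (fst S)) + 1 \<le> op_bound S"
    using * B_D_nonneg by linarith+
qed

lemma insert_op_amortized:
  assumes "invar \<delta> \<alpha> S"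
  shows "invar \<delta> \<alpha> (result (insert_op \<alpha> build x S)) \<and>
    work \<omega> (insert_op \<alpha> build x S) + potential B D (result (insert_op \<alpha> build x S))
      \<le> op_bound S + potential B D S"
proof -
  obtain t dead where S: "S = (t, dead)" by (cases S)
  have inv: "root_layered \<alpha> t" "bst (keys t)" "dead = marked t" "real dead \<le> \<delta> * real (size t)"
    using assms by (auto simp: S invar_def)
  note lookup = work_lookup[of \<omega> x t]
  show ?thesis
  proof (cases "result (lookup x t)")
    case None
    have x: "x \<notin> set_tree (keys t)" by (rule lookup_None[OF inv(2) None])
    let ?t1 = "result (grow x t)"
    let ?t2 = "result (repair \<alpha> build True x ?t1)"
    have bst: "bst (keys ?t1)" by (rule bst_grow[OF inv(2) x])
    note rep = insert_root_layered[OF build \<alpha> \<omega> K B inv(1,2) x]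
    have it: "items ?t2 = items ?t1" by (rule items_repair[OF build \<alpha> \<omega> K B bst])
    then have "bst (keys ?t2)" using bst by (simp add: bst_keys_iff)
    moreover have "marked ?t2 = marked t" using marked_eqI[OF it] by simp
    moreover have "size ?t2 = Suc (size t)"
      using arg_cong[OF it, of length] by simp
    moreover have "\<delta> * real (size t) \<le> \<delta> * real (Suc (size t))"
      using \<delta> by (intro mult_left_mono) auto
    ultimately have "invar \<delta> \<alpha> (?t2, dead)"
      using rep inv by (auto simp: invar_def)
    moreover have "B * real (slack ?t1) \<le> B * (real (slack t) + real (crit_height t))"
      using slack_grow[of x t] B_D_nonneg by (intro mult_left_mono) auto
    moreover have "\<omega> * (real (crit_height t) + 2) \<le> \<omega> * (real (crit_height t) + 5 + K)"
      using \<omega> K by (intro mult_left_mono) auto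
    moreover have "work \<omega> (grow x t) \<le> 2 * real (height t) + 1 + \<omega> * (real (crit_height t) + 2)"
      using \<omega> by (intro work_grow) auto
    ultimately show ?thesis
      using rep lookup height_grow[of x t] B_D_nonneg None
      by (simp add: insert_op_def S potential_def distrib_left)
  next
    case (Some b)
    show ?thesis
    proof (cases b)
      case True
      let ?t1 = "result (set_mark x False t)"
      have m: "Suc (marked ?t1) = marked t"
        using marked_set_mark(2)[of x t] Some True by simp
      then have "invar \<delta> \<alpha> (?t1, dead - 1)"
        using inv by (auto simp: invar_def intro!: root_layered_set_mark)
      moreover have "D * real (dead - 1) \<le> D * real dead"
        using B_D_nonneg by (intro mult_left_mono) auto
      moreover have "work \<omega> (set_mark x False t) \<le> 2 * real (height t) + 1 + \<omega>"
        using \<omega> by (intro work_set_mark) auto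
      ultimately show ?thesis
        using lookup op_bound_ge(2)[of S] Some True
        by (simp add: insert_op_def S potential_def)
    next
      case False
      then show ?thesis
        using lookup op_bound_ge(1)[of S] Some assms
        by (simp add: insert_op_def S potential_def)
    qed
  qed
qed

lemma delete_op_amortized:
  assumes "invar \<delta> \<alpha> S"
  shows "invar \<delta> \<alpha> (result (delete_op \<delta> \<alpha> build x S)) \<and>
    work \<omega> (delete_op \<delta> \<alpha> build x S) + potential B D (result (delete_op \<delta> \<alpha> build x S))
      \<le> op_bound S + potential B D S"
proof -
  obtain t dead where S: "S = (t, dead)" by (cases S)
  have inv: "root_layered \<alpha> t" "bst (keys t)" "dead = marked t" "real dead \<le> \<delta> * real (size t)"
    using assms by (auto simp: S invar_def)
  note lookup = work_lookup[of \<omega> x t]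
  show ?thesis
  proof (cases "result (lookup x t) = Some False")
    case False
    then show ?thesis
      using lookup op_bound_ge(1)[of S] assms
      by (simp add: delete_op_def S potential_def)
  next
    case True
    let ?t1 = "result (set_mark x True t)"
    let ?n = "real (size t)"
    have root: "root_layered \<alpha> ?t1" by (rule root_layered_set_mark[OF inv(1)])
    have rw: "root_weight ?t1 - 1 = size t"
      using root_weight_root_layered[OF root] by (simp add: size1_eq)
    have m: "marked ?t1 = Suc (marked t)"
      by (rule marked_set_mark(1)[OF True])
    have mark: "work \<omega> (set_mark x True t) \<le> 2 * real (height t) + 1 + \<omega>"
      using \<omega> by (intro work_set_mark) auto
    show ?thesis
    proof (cases "\<delta> * ?n \<le> real (dead + 1)")
      case False
      then have "invar \<delta> \<alpha> (?t1, dead + 1)"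
        using inv root m by (auto simp: invar_def)
      moreover have "2 * \<omega> \<le> \<omega> * (5 + K)"
        using \<omega> K by (simp add: algebra_simps)
      ultimately show ?thesis
        using lookup mark op_bound_ge(3)[of S] True False rw
        by (simp add: delete_op_def S potential_def algebra_simps)
    next
      case rebuild: True
      let ?xs = "filter (\<lambda>(_, d). \<not> d) (items ?t1)"
      let ?u = "result (build_labeled \<alpha> build True ?xs)"
      have "sorted_wrt (<) (map fst (items ?t1))"
        using inv(2) bst_keys_iff[of ?t1] by simp
      then have sorted: "sorted_wrt (<) (map fst ?xs)"
        by (simp only: sorted_wrt_map sorted_wrt_filter)
      note b = build_labeled[OF build \<alpha> \<omega> sorted]
      have "marked ?u = 0"
        by (auto simp: marked_def b(1) filter_empty_conv simp del: filter_map)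
      then have "invar \<delta> \<alpha> (?u, 0)"
        using b(1,5) sorted \<delta> by (simp add: invar_def bst_keys_iff)
      moreover have "work \<omega> (build_labeled \<alpha> build True ?xs) \<le> \<omega> * (K * (?n + 1) + 3 * ?n)"
      proof -
        have len: "real (length ?xs) \<le> ?n"
          using length_filter_le[of _ "items ?t1"] by (simp del: filter_map)
        have "work \<omega> (build_labeled \<alpha> build True ?xs)
            \<le> K * \<omega> * (real (length ?xs) + 1) + (2 + \<omega>) * real (length ?xs)"
          using b(4)[of True] by (simp add: add.commute)
        also have "\<dots> \<le> K * \<omega> * (?n + 1) + (3 * \<omega>) * ?n"
          using len \<omega> K by (intro add_mono mult_mono) auto
        finally show ?thesis by (simp add: algebra_simps)
      qed
      moreover have "2 * ?n + 1 \<le> \<omega> * (2 * ?n + 1)"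
        using mult_right_mono[OF \<omega>, of "2 * ?n + 1"] by simp
      \<comment> \<open>The rebuild is triggered when \<open>dead + 1\<close> reaches
        \<open>\<delta> * ?n\<close>. Since \<open>D * \<delta> = (6 + K) * \<omega>\<close>, the
        marks pay for every node; the last summand \<open>D\<close> comes from
        \<open>op_bound\<close>.\<close>
      moreover have "\<omega> * ((6 + K) * ?n) \<le> D * real dead + D"
      proof -
        have "\<omega> * ((6 + K) * ?n) = D * (\<delta> * ?n)" using \<delta> by (simp add: D)
        also have "\<dots> \<le> D * real (dead + 1)"
          using rebuild B_D_nonneg by (intro mult_left_mono) auto
        finally show ?thesis by (simp add: algebra_simps)
      qed
      moreover have "0 \<le> B * real (slack t)" using B_D_nonneg by simp
      ultimately show ?thesis
        using lookup mark op_bound_ge(3)[of S] True rebuild rw b(3) \<omega>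
        by (simp add: delete_op_def S potential_def flatten_simps algebra_simps)
    qed
  qed
qed

lemma perform_amortized:
  assumes "invar \<delta> \<alpha> S"
  shows "invar \<delta> \<alpha> (result (perform \<delta> \<alpha> build u S))"
    and "work \<omega> (perform \<delta> \<alpha> build u S) + potential B D (result (perform \<delta> \<alpha> build u S))
      \<le> op_bound S + potential B D S"
  using insert_op_amortized[OF assms] delete_op_amortized[OF assms] by (cases u; simp)+

section \<open>Summation over a sequence of updates\<close>

lemma invar_initial_state:
  assumes "sorted_wrt (<) ks"
  shows "invar \<delta> \<alpha> (initial_state \<alpha> build ks)" "potential B D (initial_state \<alpha> build ks) = 0"
proof -
  let ?xs = "map (\<lambda>k. (k, False)) ks"
  have sorted: "sorted_wrt (<) (map fst ?xs)"
    using assms by (simp add: comp_def)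
  note b = build_labeled[OF build \<alpha> \<omega> sorted]
  have "marked (result (build_labeled \<alpha> build True ?xs)) = 0"
    by (auto simp: marked_def b(1) filter_empty_conv)
  then show "invar \<delta> \<alpha> (initial_state \<alpha> build ks)" "potential B D (initial_state \<alpha> build ks) = 0"
    using b(1,3,5) sorted \<delta> by (simp_all add: invar_def initial_state_def potential_def bst_keys_iff)
qed

lemma invar_state_after:
  "sorted_wrt (<) ks \<Longrightarrow> invar \<delta> \<alpha> (state_after \<delta> \<alpha> build ks us)"
  by (induction us rule: rev_induct)
    (auto simp: state_after_def invar_initial_state intro: perform_amortized(1))

text \<open>The single bounds telescope, starting from potential 0.\<close>

lemma sum_work_le:
  assumes "sorted_wrt (<) ks"
  shows "m \<le> length us \<Longrightarrow>
    (\<Sum>j<m. work \<omega> (perform \<delta> \<alpha> build (us ! j) (state_after \<delta> \<alpha> build ks (take j us)))) +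
      potential B D (state_after \<delta> \<alpha> build ks (take m us))
    \<le> (\<Sum>j<m. op_bound (state_after \<delta> \<alpha> build ks (take j us)))"
proof (induction m)
  case 0
  then show ?case using invar_initial_state(2)[OF assms] by (simp add: state_after_def)
next
  case (Suc m)
  let ?S = "state_after \<delta> \<alpha> build ks (take m us)"
  have "state_after \<delta> \<alpha> build ks (take (Suc m) us) = result (perform \<delta> \<alpha> build (us ! m) ?S)"
    using Suc.prems by (simp add: take_Suc_conv_app_nth state_after_def)
  then show ?case
    using Suc perform_amortized(2)[OF invar_state_after[OF assms], of "us ! m" "take m us"] by simp
qed

text \<open>At most a fraction \<open>\<delta>\<close> of the nodes being marked, the logarithms of the size of the tree
  and of the number of objects differ by at most a constant.\<close>

lemma heights_le_log:
  assumes "invar \<delta> \<alpha> S" and "\<delta> < 1"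
    and M: "M = max 1 (log (real \<alpha>) (real (num_objects S)))" and c: "c = 20 + 9 * log 2 (1 / (1 - \<delta>))"
  shows "real (height (fst S)) \<le> c * (real \<alpha> * M)" "real (crit_height (fst S)) \<le> c * M"
proof -
  obtain t dead where S: "S = (t, dead)" by (cases S)
  have inv: "root_layered \<alpha> t" "dead = marked t" "real dead \<le> \<delta> * real (size t)"
    using assms(1) by (auto simp: S invar_def)
  have \<alpha>1: "1 < real \<alpha>" using \<alpha> by simp
  have M1: "1 \<le> M" by (simp add: M)
  have q: "1 \<le> 1 / (1 - \<delta>)" using \<delta> assms(2) by simp
  have q0: "0 \<le> log 2 (1 / (1 - \<delta>))" by (rule log_inverse_nonneg[OF \<delta> assms(2)])
  have "real (height t) \<le> c * (real \<alpha> * M) \<and> real (crit_height t) \<le> c * M"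
  proof (cases "t = \<langle>\<rangle>")
    case True
    then show ?thesis using M1 q0 c by simp
  next
    case False
    then obtain L where L: "height t \<le> 9 * \<alpha> * L + 2" "crit_height t \<le> L + 2"
        "L = 0 \<or> \<alpha> ^ (L - 1) \<le> size t"
      using root_layered_heights[OF \<alpha> inv(1)] by metis
    have "real L \<le> (2 + log 2 (1 / (1 - \<delta>))) * M"
    proof (cases "L = 0")
      case True
      then show ?thesis using M1 q0 by simp
    next
      case L0: False
      \<comment> \<open>At least a fraction \<open>1 - \<delta>\<close> of the nodes is
        unmarked.\<close>
      have n: "(1 - \<delta>) * real (size t) \<le> real (num_objects S)"
        using inv num_objects_eq[of t dead] by (simp add: S algebra_simps)
      have pos: "0 < (1 - \<delta>) * real (size t)"
        using False assms(2) by (cases t) auto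
      have "real \<alpha> ^ (L - 1) \<le> real (size t)"
        using L(3) L0 by (metis of_nat_le_iff of_nat_power)
      also have "\<dots> \<le> 1 / (1 - \<delta>) * real (num_objects S)"
        using n assms(2) by (simp add: field_simps)
      finally have "log (real \<alpha>) (real \<alpha> ^ (L - 1)) \<le> log (real \<alpha>) (1 / (1 - \<delta>) * real (num_objects S))"
        using \<alpha>1 n pos assms(2) by (subst log_le_cancel_iff) (auto intro!: divide_pos_pos)
      also have "\<dots> = log (real \<alpha>) (1 / (1 - \<delta>)) + log (real \<alpha>) (real (num_objects S))"
        using n pos assms(2) by (subst log_mult) auto
      \<comment> \<open>Passing from base \<open>\<alpha>\<close> to base 2 makes the additive
        constant independent of \<open>\<alpha>\<close>.\<close>
      also have "log (real \<alpha>) (1 / (1 - \<delta>)) \<le> log 2 (1 / (1 - \<delta>))"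
      proof -
        have "0 \<le> ln (1 / (1 - \<delta>))" using q by (simp only: ln_ge_zero)
        moreover have "ln 2 \<le> ln (real \<alpha>)" using \<alpha> by simp
        ultimately show ?thesis unfolding log_def using \<alpha>1
          by (intro divide_left_mono) auto
      qed
      also have "log (real \<alpha>) (real \<alpha> ^ (L - 1)) = real L - 1"
        using \<alpha>1 L0 by (simp add: log_nat_power of_nat_diff)
      finally have "real L \<le> 1 + log 2 (1 / (1 - \<delta>)) + M"
        by (simp add: M)
      also have "\<dots> \<le> M + log 2 (1 / (1 - \<delta>)) * M + M"
        using M1 q0 mult_left_mono[OF M1 q0] by simp
      finally show ?thesis by (simp add: algebra_simps)
    qed
    \<comment> \<open>Multiplying the bound on \<open>L\<close> by \<open>9 * \<alpha>\<close> gives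
      the 18 and the factor 9 in \<open>c\<close>; the additive 2 of the height raises 18 to
      20.\<close>
    moreover from this have "9 * (real \<alpha> * real L) \<le> 9 * (real \<alpha> * ((2 + log 2 (1 / (1 - \<delta>))) * M))"
      using \<alpha> by (intro mult_left_mono) auto
    moreover have "real (height t) \<le> 9 * (real \<alpha> * real L) + 2"
      using of_nat_mono[OF L(1), where 'a = real] by simp
    moreover have "2 \<le> 2 * (real \<alpha> * M)"
      using mult_mono[of 1 "real \<alpha>" 1 M] \<alpha> M1 by simp
    moreover have "real (crit_height t) \<le> real L + 2"
      using L(2) by simp
    moreover have "0 \<le> log 2 (1 / (1 - \<delta>)) * M" using q0 M1 by simp
    ultimately show ?thesis
      using M1 by (auto simp: c algebra_simps)
  qed
  then show "real (height (fst S)) \<le> c * (real \<alpha> * M)" "real (crit_height (fst S)) \<le> c * M"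
    by (simp_all add: S)
qed

text \<open>Long paths are traversed at unit cost per node, giving \<open>\<alpha> * M\<close>; only
  critical nodes incur writes or new slack, giving \<open>\<omega> * M\<close>. Hence the sum of
  \<open>\<omega>\<close> and \<open>\<alpha>\<close> appears rather than their product.\<close>

lemma op_bound_le:
  assumes "invar \<delta> \<alpha> S" and "\<delta> < 1" and c: "c = 20 + 9 * log 2 (1 / (1 - \<delta>))"
  shows "op_bound S \<le> (c * (19 + 2 * K) + 10 + K + (6 + K) / \<delta>) *
    ((\<omega> + real \<alpha>) * max 1 (log (real \<alpha>) (real (num_objects S))))"
proof -
  define M where "M = max 1 (log (real \<alpha>) (real (num_objects S)))"
  note h = heights_le_log[OF assms(1,2) M_def c]
  have M1: "1 \<le> M" by (simp add: M_def)
  define X where "X = (\<omega> + real \<alpha>) * M"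
  have c0: "0 \<le> c" using log_inverse_nonneg[OF \<delta> assms(2)] by (simp add: c)
  have X: "real \<alpha> * M \<le> X" "\<omega> * M \<le> X" "\<omega> \<le> X"
  proof -
    show "real \<alpha> * M \<le> X" "\<omega> * M \<le> X"
      unfolding X_def using \<omega> M1 by (intro mult_right_mono; simp)+
    moreover have "\<omega> * 1 \<le> \<omega> * M" using \<omega> M1 by (intro mult_left_mono) auto
    ultimately show "\<omega> \<le> X" by simp
  qed
  have ch: "\<omega> * real (crit_height (fst S)) \<le> c * X"
  proof -
    have "\<omega> * real (crit_height (fst S)) \<le> \<omega> * (c * M)"
      using h(2) \<omega> by (intro mult_left_mono) auto
    also have "\<dots> = c * (\<omega> * M)" by simp
    also have "\<dots> \<le> c * X" using X c0 by (intro mult_left_mono)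
    finally show ?thesis .
  qed
  have "op_bound S = 6 * real (height (fst S)) + 5 + (13 + 2 * K) * (\<omega> * real (crit_height (fst S))) +
      (5 + K + (6 + K) / \<delta>) * \<omega>"
    by (simp add: B D algebra_simps)
  also have "\<dots> \<le> 6 * (c * X) + 5 * X + (13 + 2 * K) * (c * X) + (5 + K + (6 + K) / \<delta>) * X"
  proof (intro add_mono)
    have "c * (real \<alpha> * M) \<le> c * X" using X c0 by (intro mult_left_mono)
    then show "6 * real (height (fst S)) \<le> 6 * (c * X)" using h(1) by simp
    show "5 \<le> 5 * X" using X(3) \<omega> by simp
    show "(13 + 2 * K) * (\<omega> * real (crit_height (fst S))) \<le> (13 + 2 * K) * (c * X)"
      using ch K by (intro mult_left_mono) auto
    show "(5 + K + (6 + K) / \<delta>) * \<omega> \<le> (5 + K + (6 + K) / \<delta>) * X"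
      using X(3) K \<delta> by (intro mult_left_mono) auto
  qed
  also have "\<dots> = (c * (19 + 2 * K) + 10 + K + (6 + K) / \<delta>) * X"
    by (simp add: algebra_simps)
  finally show ?thesis by (simp add: X_def M_def)
qed

end

theorem theorem5:
  fixes \<delta> K :: real
  assumes "0 < \<delta>" and "\<delta> < 1" and "0 < K"
  shows "\<exists>C>0. \<forall>(\<alpha>::nat) (\<omega>::real) (build :: ('k :: linorder) builder) (ks :: 'k list)
            (us :: 'k update list).
          2 \<le> \<alpha> \<longrightarrow> 1 \<le> \<omega> \<longrightarrow> rebuilder K \<omega> build \<longrightarrow> sorted_wrt (<) ks \<longrightarrow>
          (\<Sum>j<length us. work \<omega> (perform \<delta> \<alpha> build (us ! j)
                                        (state_after \<delta> \<alpha> build ks (take j us))))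
          \<le> C * (\<Sum>j<length us. (\<omega> + real \<alpha>) *
                   max 1 (log (real \<alpha>)
                     (real (num_objects (state_after \<delta> \<alpha> build ks (take j us))))))"
proof -
  \<comment> \<open>Both constants depend on \<open>\<delta>\<close> and \<open>K\<close> only, so
    they can be fixed before \<open>\<alpha>\<close>, \<open>\<omega>\<close> and the update
    sequence.\<close>
  define c where "c = 20 + 9 * log 2 (1 / (1 - \<delta>))"
  define C where "C = c * (19 + 2 * K) + 10 + K + (6 + K) / \<delta>"
  have "0 \<le> c" using log_inverse_nonneg[OF assms(1,2)] by (simp add: c_def)
  then have "0 < C"
    using assms by (simp add: C_def add_nonneg_pos add_pos_pos)
  moreover have "(\<Sum>j<length us. work \<omega> (perform \<delta> \<alpha> build (us ! j)
                                        (state_after \<delta> \<alpha> build ks (take j us))))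
          \<le> C * (\<Sum>j<length us. (\<omega> + real \<alpha>) *
                   max 1 (log (real \<alpha>)
                     (real (num_objects (state_after \<delta> \<alpha> build ks (take j us))))))"
    if \<alpha>: "2 \<le> \<alpha>" and \<omega>: "1 \<le> \<omega>" and build: "rebuilder K \<omega> build" and ks: "sorted_wrt (<) ks"
    for \<alpha> :: nat and \<omega> :: real and build :: "'k builder" and ks :: "'k list" and us :: "'k update list"
  proof -
    note ctxt = build \<alpha> \<omega> assms(3) refl refl assms(1)
    let ?S = "\<lambda>j. state_after \<delta> \<alpha> build ks (take j us)"
    \<comment> \<open>Nonnegativity allows the final potential to be dropped from the telescoped
      sum.\<close>
    have "0 \<le> potential (2 * (6 + K) * \<omega>) ((6 + K) / \<delta> * \<omega>) (?S (length us))"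
      using assms \<omega> by (simp add: potential_def)
    with sum_work_le[OF ctxt ks order_refl, of us]
    have "(\<Sum>j<length us. work \<omega> (perform \<delta> \<alpha> build (us ! j) (?S j)))
      \<le> (\<Sum>j<length us. 6 * real (height (fst (?S j))) + 5 +
            \<omega> * (real (crit_height (fst (?S j))) + 5 + K) +
            2 * (6 + K) * \<omega> * real (crit_height (fst (?S j))) + (6 + K) / \<delta> * \<omega>)"
      by linarith
    also have "\<dots> \<le> (\<Sum>j<length us. C * ((\<omega> + real \<alpha>) *
                   max 1 (log (real \<alpha>) (real (num_objects (?S j))))))"
      unfolding C_def
      by (intro sum_mono op_bound_le[OF ctxt _ assms(2) c_def] invar_state_after[OF ctxt ks])
    finally show ?thesis by (simp add: sum_distrib_left)
  qed
  ultimately show ?thesis by blast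
qed

end
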